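(* Let $\mathbb{K}$ be a field and let $I\subset\mathbb{K}[X_1,\dots,X_n]$ be a symmetric ideal. Assume that there exists $P\in I$ of degree $d$ such that $\mathrm{wt}(P_d)+d\le n$, and let $m\in\mathrm{Mon}(P_d)$. Then $$V(I)\cap H_\lambda=\emptyset\quad\text{for all partitions }\lambda\text{ of }n\text{ with }\lambda\trianglelefteq\mu(m)^\perp.$$ In other words, $$V(I)/S_n=\bigcup_{\nu\not\trianglelefteq\mu(m)^\perp}\Phi_\nu\big(V(I^\nu)\big),$$ where $\nu$ runs over the partitions of $n$ that are not dominated by $\mu(m)^\perp$.
   Context: The symmetric group $S_n$ acts on $\mathbb{K}^n$ by permuting coordinates and on $\mathbb{K}[X_1,\dots,X_n]$ by permuting the variables; an ideal $I$ is symmetric if $\sigma P\in I$ for all $P\in I$, $\sigma\in S_n$. $V(I)\subset\mathbb{K}^n$ is the set of common zeros in $\mathbb{K}^n$ of all polynomials in $I$; if $I$ is symmetric then $V(I)$ is $S_n$-stable, and $V(I)/S_n$ is its set of orbits. For a polynomial $P$, $P_h$ is its homogeneous component of degree $h$ and $\mathrm{Mon}(P)$ is the set of monomials appearing in $P$ (with nonzero coefficient). The support of a monomial $\prod_j X_j^{k_j}$ is $\{j:k_j\neq0\}$, its weight is the cardinality of its support, and $\mathrm{wt}(P)$ is the cardinality of the union of the supports of the monomials in $\mathrm{Mon}(P)$. A partition of $n$ is a weakly decreasing sequence of positive integers with sum $n$; $\mathrm{len}$ denotes the number of parts. The dual partition is $(\lambda^\perp)_i=|\{j:\lambda_j\ge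 i\}|$. For partitions $\lambda,\mu$ of $n$, $\mu$ dominates $\lambda$ (written $\lambda\trianglelefteq\mu$) if $\sum_{j=1}^i\mu_j\ge\sum_{j=1}^i\lambda_j$ for all $1\le i\le\min\{\mathrm{len}(\lambda),\mathrm{len}(\mu)\}$. For a monomial $m$ of degree $d$ and weight $l$ with $d+l\le n$, let $(\lambda_1,\dots,\lambda_l)$ be the partition of $d$ formed by the nonzero exponents of $m$ in decreasing order; then $\mu(m)=(\lambda_1+1,\dots,\lambda_l+1,1,\dots,1)$ with $n-d-l$ trailing ones, a partition of $n$. For $x\in\mathbb{K}^n$, the stabilizer of $x$ in $S_n$ is of the form $S_{\ell_1}\times\dots\times S_{\ell_k}$ with $\ell_1\ge\dots\ge\ell_k$, where $\ell_1,\dots,\ell_k$ are the multiplicities of the distinct coordinates of $x$; the orbit type of $x$ is the partition $\Lambda(x)=(\ell_1,\dots,\ell_k)$ of $n$. Put $H_\lambda=\{x\in\mathbb{K}^n:\Lambda(x)=\lambda\}$. For a partition $\nu=(\nu_1,\dots,\nu_k)$ of $n$ of length $k$ and $P\in\mathbb{K}[X_1,\dots,X_n]$, let $P^\nu\in\mathbb{K}[Z_1,\dots,Z_k]$ be obtained from $P$ by substituting $Z_1$ for the first $\nu_1$ variables, $Z_2$ for the next $\nu_2$ variables, ..., $Z_k$ for the last $\nu_k$ variables. $I^\nu=\{P^\nu:P\in I\}$ is the resulting ideal of $\mathbb{K}[Z_1,\dots,Z_k]$, and $V(I^\nu)\subset\mathbb{K}^k$ is its zero set. The map $\Phi_\nu:V(I^\nu)\to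 V(I)/S_n$ sends $(x_1,\dots,x_k)$ to the $S_n$-orbit of the point $(x_1,\dots,x_1,x_2,\dots,x_2,\dots,x_k,\dots,x_k)$, where $x_i$ is repeated $\nu_i$ times. *)

theory Defs
  imports "HOL-Library.Poly_Mapping" "HOL-Algebra.Ideal" "HOL-Combinatorics.List_Permutation"
begin

text \<open>
  A polynomial is a finitely supported family of coefficients indexed by exponent vectors.
  The variables are numbered from 0, so \<open>K[X\<^sub>1,\<dots>,X\<^sub>n]\<close> consists of the polynomials that only
  involve variables with index less than \<open>n\<close>. Points of \<open>K\<^sup>n\<close> are lists of length \<open>n\<close>.
\<close>

type_synonym 'a mpol = "(nat \<Rightarrow>\<^sub>0 nat) \<Rightarrow>\<^sub>0 'a"

definition Mon :: "'a::zero mpol \<Rightarrow> (nat \<Rightarrow>\<^sub>0 nat) set" where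
  "Mon P = Poly_Mapping.keys P"

definition mon_support :: "(nat \<Rightarrow>\<^sub>0 nat) \<Rightarrow> nat set" where
  "mon_support m = Poly_Mapping.keys m"

definition mon_degree :: "(nat \<Rightarrow>\<^sub>0 nat) \<Rightarrow> nat" where
  "mon_degree m = (\<Sum>j\<in>mon_support m. Poly_Mapping.lookup m j)"

definition mon_weight :: "(nat \<Rightarrow>\<^sub>0 nat) \<Rightarrow> nat" where
  "mon_weight m = card (mon_support m)"

definition mpol_support :: "'a::zero mpol \<Rightarrow> nat set" where
  "mpol_support P = (\<Union>m\<in>Mon P. mon_support m)"

definition wt :: "'a::zero mpol \<Rightarrow> nat" where
  "wt P = card (mpol_support P)"

text \<open>The zero polynomial is given degree 0; all its homogeneous components are 0.\<close>

definition total_degree :: "'a::zero mpol \<Rightarrow> nat" where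
  "total_degree P = Max (insert 0 (mon_degree ` Mon P))"

definition hom_component :: "nat \<Rightarrow> 'a::comm_monoid_add mpol \<Rightarrow> 'a mpol" where
  "hom_component h P = (\<Sum>m\<in>{m \<in> Mon P. mon_degree m = h}. Poly_Mapping.single m (Poly_Mapping.lookup P m))"

definition mpol_ring :: "nat \<Rightarrow> 'a::comm_ring_1 mpol ring" where
  "mpol_ring n = \<lparr>carrier = {P. mpol_support P \<subseteq> {..<n}}, monoid.mult = (*), one = 1, zero = 0, add = (+)\<rparr>"

lemma mpol_ring_cring: "cring (mpol_ring n :: 'a::comm_ring_1 mpol ring)"
proof -
  have add: "mpol_support (P + Q) \<subseteq> mpol_support P \<union> mpol_support Q" for P Q :: "'a mpol"
    using keys_add[of P Q] unfolding mpol_support_def Mon_def by blast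
  have uminus: "mpol_support (- P) = mpol_support P" for P :: "'a mpol"
    by (auto simp: mpol_support_def Mon_def in_keys_iff)
  have mult: "mpol_support (P * Q) \<subseteq> mpol_support P \<union> mpol_support Q" for P Q :: "'a mpol"
  proof
    fix j assume "j \<in> mpol_support (P * Q)"
    then obtain m where m: "m \<in> Poly_Mapping.keys (P * Q)" "j \<in> Poly_Mapping.keys m"
      unfolding mpol_support_def Mon_def mon_support_def by blast
    obtain a b where ab: "a \<in> Poly_Mapping.keys P" "b \<in> Poly_Mapping.keys Q" "m = a + b"
      using m(1) keys_mult[of P Q] by blast
    then have "j \<in> Poly_Mapping.keys a \<union> Poly_Mapping.keys b"
      using m(2) keys_add[of a b] by blast
    then show "j \<in> mpol_support P \<union> mpol_support Q"
      using ab unfolding mpol_support_def Mon_def mon_support_def by blast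
  qed
  have one: "mpol_support (1 :: 'a mpol) = {}"
    by (simp add: mpol_support_def Mon_def mon_support_def)
  have zero: "mpol_support (0 :: 'a mpol) = {}"
    by (auto simp: mpol_support_def Mon_def in_keys_iff)
  have neg: "\<exists>Q. mpol_support Q \<subseteq> {..<n} \<and> Q + P = 0" if "mpol_support P \<subseteq> {..<n}" for P :: "'a mpol"
    using that by (intro exI[of _ "- P"]) (simp add: uminus)
  have "abelian_group (mpol_ring n :: 'a mpol ring)"
  proof (rule abelian_groupI)
    fix P assume "P \<in> carrier (mpol_ring n :: 'a mpol ring)"
    then show "\<exists>Q\<in>carrier (mpol_ring n). Q \<oplus>\<^bsub>mpol_ring n\<^esub> P = \<zero>\<^bsub>mpol_ring n\<^esub>"
      using neg[of P] unfolding mpol_ring_def by auto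
  next
    fix P Q :: "'a mpol" assume "P \<in> carrier (mpol_ring n :: 'a mpol ring)" "Q \<in> carrier (mpol_ring n)"
    then show "P \<oplus>\<^bsub>mpol_ring n\<^esub> Q \<in> carrier (mpol_ring n)"
      using add[of P Q] unfolding mpol_ring_def by auto
  qed (simp_all add: mpol_ring_def zero add_ac)
  moreover have "Group.comm_monoid (mpol_ring n :: 'a mpol ring)"
  proof (rule comm_monoidI)
    fix P Q :: "'a mpol" assume "P \<in> carrier (mpol_ring n :: 'a mpol ring)" "Q \<in> carrier (mpol_ring n)"
    then show "P \<otimes>\<^bsub>mpol_ring n\<^esub> Q \<in> carrier (mpol_ring n)"
      using mult[of P Q] unfolding mpol_ring_def by auto
  qed (simp_all add: mpol_ring_def one mult_ac)
  ultimately show ?thesis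
    by (rule cringI) (simp add: mpol_ring_def distrib_right)
qed

definition rename_vars :: "(nat \<Rightarrow> nat) \<Rightarrow> 'a::comm_monoid_add mpol \<Rightarrow> 'a mpol" where
  "rename_vars f P =
     (\<Sum>m\<in>Mon P. Poly_Mapping.single (\<Sum>j\<in>mon_support m. Poly_Mapping.single (f j) (Poly_Mapping.lookup m j)) (Poly_Mapping.lookup P m))"

definition symmetric_ideal :: "nat \<Rightarrow> 'a::comm_ring_1 mpol set \<Rightarrow> bool" where
  "symmetric_ideal n I \<longleftrightarrow>
     ideal I (mpol_ring n) \<and> (\<forall>\<sigma> P. \<sigma> permutes {..<n} \<longrightarrow> P \<in> I \<longrightarrow> rename_vars \<sigma> P \<in> I)"

definition mpol_eval :: "'a list \<Rightarrow> 'a::comm_semiring_1 mpol \<Rightarrow> 'a" where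
  "mpol_eval x P = (\<Sum>m\<in>Mon P. Poly_Mapping.lookup P m * (\<Prod>j\<in>mon_support m. (x ! j) ^ Poly_Mapping.lookup m j))"

definition zero_set :: "nat \<Rightarrow> 'a::comm_semiring_1 mpol set \<Rightarrow> 'a list set" where
  "zero_set k J = {x. length x = k \<and> (\<forall>P\<in>J. mpol_eval x P = 0)}"

text \<open>
  Entry \<open>i\<close> of \<open>permute_list \<sigma> x\<close> is \<open>x ! \<sigma> i\<close>, which is the action of the inverse of \<open>\<sigma>\<close>;
  the orbits do not depend on this convention.
\<close>

definition Sn_orbit :: "'a list \<Rightarrow> 'a list set" where
  "Sn_orbit x = {permute_list \<sigma> x | \<sigma>. \<sigma> permutes {..<length x}}"

definition Sn_orbits :: "'a list set \<Rightarrow> 'a list set set" where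
  "Sn_orbits V = Sn_orbit ` V"

definition is_partition :: "nat \<Rightarrow> nat list \<Rightarrow> bool" where
  "is_partition n \<kappa> \<longleftrightarrow> sorted_wrt (\<ge>) \<kappa> \<and> (\<forall>p\<in>set \<kappa>. p > 0) \<and> sum_list \<kappa> = n"

text \<open>The nonzero entries of the dual partition are those with index from 1 to \<open>\<kappa>\<^sub>1\<close>.\<close>

definition dual_partition :: "nat list \<Rightarrow> nat list" where
  "dual_partition \<kappa> =
     map (\<lambda>i. card {j. j < length \<kappa> \<and> \<kappa> ! j \<ge> i}) [1..<Suc (if \<kappa> = [] then 0 else hd \<kappa>)]"

text \<open>Only used for partitions of the same number.\<close>

definition dominated_by :: "nat list \<Rightarrow> nat list \<Rightarrow> bool" (infix \<open>\<unlhd>\<close> 50) where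
  "\<kappa> \<unlhd> \<mu> \<longleftrightarrow>
     (\<forall>i\<in>{1..min (length \<kappa>) (length \<mu>)}. sum_list (take i \<mu>) \<ge> sum_list (take i \<kappa>))"

definition mon_exponents :: "(nat \<Rightarrow>\<^sub>0 nat) \<Rightarrow> nat list" where
  "mon_exponents m = rev (sort (map (Poly_Mapping.lookup m) (sorted_list_of_set (mon_support m))))"

definition mon_partition :: "nat \<Rightarrow> (nat \<Rightarrow>\<^sub>0 nat) \<Rightarrow> nat list" where
  "mon_partition n m =
     map (\<lambda>e. e + 1) (mon_exponents m) @ replicate (n - mon_degree m - mon_weight m) 1"

definition orbit_type :: "'a list \<Rightarrow> nat list" where
  "orbit_type x = rev (sort (map (count_list x) (remdups x)))"

definition points_of_type :: "nat \<Rightarrow> nat list \<Rightarrow> 'a list set" where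
  "points_of_type n \<kappa> = {x. length x = n \<and> orbit_type x = \<kappa>}"

text \<open>
  \<open>spread \<nu> [x\<^sub>1,\<dots>,x\<^sub>k]\<close> repeats each \<open>x\<^sub>i\<close> \<open>\<nu>\<^sub>i\<close> times. Applied to the list of the indices
  of \<open>Z\<^sub>1,\<dots>,Z\<^sub>k\<close>, it lists the index of the variable substituted for each of \<open>X\<^sub>1,\<dots>,X\<^sub>n\<close>.
\<close>

definition spread :: "nat list \<Rightarrow> 'b list \<Rightarrow> 'b list" where
  "spread \<nu> x = concat (map2 replicate \<nu> x)"

definition merge_vars :: "nat list \<Rightarrow> 'a::comm_monoid_add mpol \<Rightarrow> 'a mpol" where
  "merge_vars \<nu> P = rename_vars (\<lambda>j. spread \<nu> [0..<length \<nu>] ! j) P"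

definition Phi :: "nat list \<Rightarrow> 'a list \<Rightarrow> 'a list set" where
  "Phi \<nu> x = Sn_orbit (spread \<nu> x)"

end

theory Submission
  imports Defs
begin

text \<open>
  Let \<open>m = X\<^bsub>s\<^sub>1\<^esub>\<^bsup>\<lambda>\<^sub>1\<^esup> \<dots> X\<^bsub>s\<^sub>l\<^esub>\<^bsup>\<lambda>\<^sub>l\<^esup>\<close>. The hypothesis \<open>wt(P\<^sub>d) + d \<le> n\<close> leaves room for \<open>d\<close> variables that do not
  occur in the top degree part \<open>P\<^sub>d\<close>. Attach \<open>\<lambda>\<^sub>i\<close> of them to \<open>X\<^bsub>s\<^sub>i\<^esub>\<close>; this gives disjoint blocks of
  variables of sizes \<open>\<lambda>\<^sub>i + 1\<close>, which together with single variables form a set partition of the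
  variables with block sizes \<open>\<mu>(m)\<close>.

  The combinatorial half is the Gale--Ryser theorem. If the multiplicities of the coordinates of a
  point \<open>x\<close> form a partition dominated by \<open>\<mu>(m)\<^sup>\<bottom>\<close>, then the coordinates can be permuted so that they are
  pairwise distinct on every block (\<open>gale_ryser\<close>, \<open>obtain_permutation_separating_blocks\<close>).

  The algebraic half shows that a zero of a symmetric ideal \<open>I\<close> containing \<open>P\<close> cannot be permuted in this
  way. Let \<open>W\<close> be the set of all such rearrangements of \<open>x\<close>. Then \<open>P\<close> vanishes on \<open>W\<close>, and \<open>W\<close> is stable under
  swaps within a block. Therefore the divided difference \<open>(P - \<tau>P) / (X\<^sub>a - X\<^sub>c)\<close> with
  \<open>\<tau> = (a c)\<close> vanishes on \<open>W\<close> as well, for \<open>a\<close> and \<open>c\<close> in the same block. Apply in turn the \<open>d\<close> divided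
  differences that pair a variable of \<open>m\<close> with the variables attached to it. Each one lowers the degree by
  one, so the parts of \<open>P\<close> of degree less than \<open>d\<close> contribute nothing in the end. A monomial of \<open>P\<^sub>d\<close>
  contributes only if its exponents are at least those of \<open>m\<close>, that is, only if it is \<open>m\<close>. What
  remains is the coefficient of \<open>m\<close>, a nonzero constant that vanishes on \<open>W\<close>; so \<open>W\<close> is empty
  (\<open>vanishing_on_swap_closed_set_imp_empty\<close>). Divided differences replace antisymmetrization, hence the
  argument works in every characteristic.

  The description of the orbits follows: every zero is a permutation of \<open>spread \<nu> y\<close> where \<open>\<nu>\<close> is its orbit
  type, and substituting \<open>y\<close> into \<open>P\<^sup>\<nu>\<close> is the same as substituting \<open>spread \<nu> y\<close> into \<open>P\<close>.
\<close>

section \<open>Evaluating polynomials at families of values\<close>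

text \<open>
  Points are functions on the variable indices here rather than lists, so that permuting
  coordinates is composition and no bounds on indices are needed.
\<close>
definition mon_at :: "(nat \<Rightarrow> 'a::comm_semiring_1) \<Rightarrow> (nat \<Rightarrow>\<^sub>0 nat) \<Rightarrow> 'a" where
  "mon_at z e = (\<Prod>j\<in>mon_support e. z j ^ Poly_Mapping.lookup e j)"

definition eval_at :: "(nat \<Rightarrow> 'a::comm_semiring_1) \<Rightarrow> 'a mpol \<Rightarrow> 'a" where
  "eval_at z P = (\<Sum>e\<in>Mon P. Poly_Mapping.lookup P e * mon_at z e)"

lemma mpol_eval_eq_eval_at: "mpol_eval x P = eval_at ((!) x) P"
  by (simp add: mpol_eval_def eval_at_def mon_at_def)

lemma mon_degree_superset:
  assumes "finite F" "mon_support e \<subseteq> F"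
  shows "mon_degree e = (\<Sum>j\<in>F. Poly_Mapping.lookup e j)"
  unfolding mon_degree_def using assms
  by (intro sum.mono_neutral_left) (auto simp: mon_support_def in_keys_iff)

lemma mon_degree_add: "mon_degree (e + f) = mon_degree e + mon_degree f"
proof -
  let ?F = "mon_support e \<union> mon_support f"
  have "mon_support (e + f) \<subseteq> ?F"
    unfolding mon_support_def by (rule keys_add)
  then show ?thesis
    using mon_degree_superset[of ?F] by (simp add: lookup_add sum.distrib mon_support_def)
qed

lemma mon_degree_single [simp]: "mon_degree (Poly_Mapping.single j k) = k"
  by (simp add: mon_degree_def mon_support_def)

lemma mon_degree_0 [simp]: "mon_degree 0 = 0"
  by (simp add: mon_degree_def mon_support_def)

lemma mon_degree_eq_0_iff [simp]: "mon_degree e = 0 \<longleftrightarrow> e = 0"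
  by (auto simp: mon_degree_def mon_support_def in_keys_iff intro!: poly_mapping_eqI)

lemma mon_at_superset:
  assumes "finite F" "mon_support e \<subseteq> F"
  shows "mon_at z e = (\<Prod>j\<in>F. z j ^ Poly_Mapping.lookup e j)"
  unfolding mon_at_def using assms
  by (intro prod.mono_neutral_left) (auto simp: mon_support_def in_keys_iff)

lemma mon_at_add: "mon_at z (e + f) = mon_at z e * mon_at z f"
proof -
  let ?F = "mon_support e \<union> mon_support f"
  have "mon_support (e + f) \<subseteq> ?F"
    unfolding mon_support_def by (rule keys_add)
  then show ?thesis
    using mon_at_superset[of ?F e z] mon_at_superset[of ?F f z] mon_at_superset[of ?F "e + f" z]
    by (simp add: lookup_add prod.distrib power_add mon_support_def)
qed

lemma mon_at_single [simp]: "mon_at z (Poly_Mapping.single j k) = z j ^ k"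
  by (simp add: mon_at_def mon_support_def)

lemma mon_at_0 [simp]: "mon_at z 0 = 1"
  by (simp add: mon_at_def mon_support_def)

lemma mon_at_sum: "mon_at z (sum f A) = (\<Prod>i\<in>A. mon_at z (f i))"
  by (induction A rule: infinite_finite_induct) (simp_all add: mon_at_add)

lemma mon_at_transpose:
  assumes "Poly_Mapping.lookup e a = Poly_Mapping.lookup e c"
  shows "mon_at (z \<circ> transpose a c) e = mon_at z e"
proof -
  let ?\<tau> = "transpose a c"
  let ?F = "insert a (insert c (mon_support e))"
  have "?\<tau> permutes ?F"
    by (rule permutes_swap_id) auto
  have inv: "Poly_Mapping.lookup e (?\<tau> j) = Poly_Mapping.lookup e j" for j
    using assms by (auto simp: transpose_def)
  have "mon_at z e = (\<Prod>j\<in>?F. z j ^ Poly_Mapping.lookup e j)"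
    by (rule mon_at_superset) (auto simp: mon_support_def)
  also have "\<dots> = (\<Prod>j\<in>?F. (z \<circ> ?\<tau>) j ^ Poly_Mapping.lookup e j)"
    by (subst prod.permute[OF \<open>?\<tau> permutes ?F\<close>]) (simp only: o_def inv)
  also have "\<dots> = mon_at (z \<circ> ?\<tau>) e"
    by (rule mon_at_superset[symmetric]) (auto simp: mon_support_def)
  finally show ?thesis ..
qed

lemma eval_at_superset:
  assumes "finite F" "Mon P \<subseteq> F"
  shows "eval_at z P = (\<Sum>e\<in>F. Poly_Mapping.lookup P e * mon_at z e)"
  unfolding eval_at_def using assms
  by (intro sum.mono_neutral_left) (auto simp: Mon_def in_keys_iff)

lemma eval_at_add: "eval_at z (P + Q) = eval_at z P + eval_at z Q"
proof -
  let ?F = "Mon P \<union> Mon Q"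
  have "Mon (P + Q) \<subseteq> ?F"
    unfolding Mon_def by (rule keys_add)
  then show ?thesis
    using eval_at_superset[of ?F P] eval_at_superset[of ?F Q] eval_at_superset[of ?F "P + Q"]
    by (simp add: lookup_add sum.distrib distrib_right Mon_def)
qed

lemma eval_at_0 [simp]: "eval_at z 0 = 0"
  by (simp add: eval_at_def Mon_def)

lemma eval_at_diff:
  fixes P Q :: "'a::comm_ring_1 mpol"
  shows "eval_at z (P - Q) = eval_at z P - eval_at z Q"
  using eval_at_add[of z "P - Q" Q] by (simp add: algebra_simps)

lemma eval_at_sum: "eval_at z (sum f A) = (\<Sum>i\<in>A. eval_at z (f i))"
  by (induction A rule: infinite_finite_induct) (simp_all add: eval_at_add)

lemma eval_at_single [simp]: "eval_at z (Poly_Mapping.single e r) = r * mon_at z e"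
  by (simp add: eval_at_def Mon_def)

lemma eval_at_rename_vars: "eval_at z (rename_vars f P) = eval_at (z \<circ> f) P"
  by (simp add: rename_vars_def eval_at_sum mon_at_sum) (simp add: eval_at_def mon_at_def)

lemma eval_at_cong:
  assumes "\<And>j. j \<in> mpol_support P \<Longrightarrow> z j = z' j"
  shows "eval_at z P = eval_at z' P"
  unfolding eval_at_def mon_at_def
  by (intro sum.cong prod.cong arg_cong2[where f="(*)"] arg_cong2[where f="(^)"] refl assms)
     (auto simp: mpol_support_def)

section \<open>Divided differences\<close>

text \<open>
  Write \<open>r e = r t X\<^sub>a\<^sup>k\<close>, where \<open>t\<close> has equal exponents in \<open>X\<^sub>a\<close> and \<open>X\<^sub>c\<close>; this is possible when
  the exponent of \<open>X\<^sub>a\<close> in \<open>e\<close> is at least that of \<open>X\<^sub>c\<close>. The polynomial is then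
  \<open>r t (X\<^sub>a\<^sup>k - X\<^sub>c\<^sup>k) / (X\<^sub>a - X\<^sub>c)\<close>, expanded as a geometric sum. In the opposite case the
  truncated difference makes \<open>k = 0\<close>, and the value is 0. Exchanging \<open>a\<close> and \<open>c\<close> covers that
  case.
\<close>
definition half_divdiff :: "nat \<Rightarrow> nat \<Rightarrow> (nat \<Rightarrow>\<^sub>0 nat) \<Rightarrow> 'a::comm_ring_1 \<Rightarrow> 'a mpol" where
  "half_divdiff a c e r =
     (let k = Poly_Mapping.lookup e a - Poly_Mapping.lookup e c; t = e - Poly_Mapping.single a k
      in \<Sum>i<k. Poly_Mapping.single (t + Poly_Mapping.single a i + Poly_Mapping.single c (k - Suc i)) r)"

lemma diff_single_add_single:
  fixes e :: "nat \<Rightarrow>\<^sub>0 nat"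
  assumes "k \<le> Poly_Mapping.lookup e a"
  shows "e - Poly_Mapping.single a k + Poly_Mapping.single a k = e"
  using assms by (intro poly_mapping_eqI) (auto simp: lookup_add lookup_minus lookup_single when_def)

lemma Mon_half_divdiffE:
  assumes "f \<in> Mon (half_divdiff a c e r)"
  obtains i where "i < Poly_Mapping.lookup e a - Poly_Mapping.lookup e c"
    "f = e - Poly_Mapping.single a (Poly_Mapping.lookup e a - Poly_Mapping.lookup e c) +
       Poly_Mapping.single a i +
       Poly_Mapping.single c (Poly_Mapping.lookup e a - Poly_Mapping.lookup e c - Suc i)"
proof -
  let ?k = "Poly_Mapping.lookup e a - Poly_Mapping.lookup e c"
  have "f \<in> (\<Union>i<?k. Poly_Mapping.keys (Poly_Mapping.single
      (e - Poly_Mapping.single a ?k + Poly_Mapping.single a i + Poly_Mapping.single c (?k - Suc i)) r))"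
    using assms unfolding Mon_def half_divdiff_def Let_def by (rule subsetD[OF keys_sum])
  then show thesis
    using that by (auto split: if_splits)
qed

lemma mon_degree_half_divdiff:
  assumes "f \<in> Mon (half_divdiff a c e r)"
  shows "Suc (mon_degree f) = mon_degree e"
proof -
  let ?k = "Poly_Mapping.lookup e a - Poly_Mapping.lookup e c"
  obtain i where i: "i < ?k" "f = e - Poly_Mapping.single a ?k +
       Poly_Mapping.single a i + Poly_Mapping.single c (?k - Suc i)"
    using assms by (rule Mon_half_divdiffE)
  have "Suc (mon_degree f) = mon_degree (e - Poly_Mapping.single a ?k + Poly_Mapping.single a ?k)"
    using i by (simp add: mon_degree_add)
  also have "\<dots> = mon_degree e"
    by (subst diff_single_add_single) simp_all
  finally show ?thesis .
qed

lemma mon_support_half_divdiff: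
  assumes "f \<in> Mon (half_divdiff a c e r)"
  shows "mon_support f \<subseteq> insert a (insert c (mon_support e))"
proof -
  let ?k = "Poly_Mapping.lookup e a - Poly_Mapping.lookup e c"
  obtain i where i: "f = e - Poly_Mapping.single a ?k +
       Poly_Mapping.single a i + Poly_Mapping.single c (?k - Suc i)"
    using assms by (rule Mon_half_divdiffE)
  show ?thesis
  proof
    fix j assume "j \<in> mon_support f"
    then show "j \<in> insert a (insert c (mon_support e))"
      by (cases "j = a \<or> j = c")
         (auto simp: i mon_support_def in_keys_iff lookup_add lookup_minus lookup_single)
  qed
qed

lemma eval_at_half_divdiff:
  "(z a - z c) * eval_at z (half_divdiff a c e r) =
     (if Poly_Mapping.lookup e c \<le> Poly_Mapping.lookup e a
      then r * (mon_at z e - mon_at (z \<circ> transpose a c) e) else 0)"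
proof (cases "Poly_Mapping.lookup e c \<le> Poly_Mapping.lookup e a \<and> a \<noteq> c")
  case False
  then show ?thesis
    by (auto simp: half_divdiff_def)
next
  case True
  define k where "k = Poly_Mapping.lookup e a - Poly_Mapping.lookup e c"
  define t where "t = e - Poly_Mapping.single a k"
  have e: "e = t + Poly_Mapping.single a k"
    unfolding t_def k_def by (simp add: diff_single_add_single)
  have sym: "Poly_Mapping.lookup t a = Poly_Mapping.lookup t c"
    using True by (simp add: t_def k_def lookup_minus lookup_single)
  have "(z a - z c) * eval_at z (half_divdiff a c e r) =
      r * mon_at z t * ((z a - z c) * (\<Sum>i<k. z c ^ (k - Suc i) * z a ^ i))"
    unfolding half_divdiff_def Let_def k_def[symmetric] t_def[symmetric]
    by (simp add: eval_at_sum mon_at_add sum_distrib_left mult_ac)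
  also have "(z a - z c) * (\<Sum>i<k. z c ^ (k - Suc i) * z a ^ i) = z a ^ k - z c ^ k"
    by (simp add: power_diff_sumr2)
  also have "r * mon_at z t * (z a ^ k - z c ^ k) =
      r * (mon_at z e - mon_at (z \<circ> transpose a c) e)"
    by (subst (1 2) e) (simp add: mon_at_add mon_at_transpose[OF sym] algebra_simps)
  finally show ?thesis
    using True by simp
qed

text \<open>
  The divided difference \<open>(P - \<tau>P) / (X\<^sub>a - X\<^sub>c)\<close> for the transposition \<open>\<tau> = (a c)\<close>. The second half
  enters with a minus sign because it has the denominator \<open>X\<^sub>c - X\<^sub>a\<close>.
\<close>
definition divdiff :: "nat \<Rightarrow> nat \<Rightarrow> 'a::comm_ring_1 mpol \<Rightarrow> 'a mpol" where
  "divdiff a c P =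
     (\<Sum>e\<in>Mon P. half_divdiff a c e (Poly_Mapping.lookup P e) -
        half_divdiff c a e (Poly_Mapping.lookup P e))"

lemma eval_at_divdiff:
  "(z a - z c) * eval_at z (divdiff a c P) = eval_at z P - eval_at (z \<circ> transpose a c) P"
proof -
  have "(z a - z c) * eval_at z (half_divdiff a c e r - half_divdiff c a e r) =
      r * (mon_at z e - mon_at (z \<circ> transpose a c) e)" (is "?l = ?r") for e r
  proof -
    have "?l = (z a - z c) * eval_at z (half_divdiff a c e r) + (z c - z a) * eval_at z (half_divdiff c a e r)"
      by (simp add: eval_at_diff algebra_simps)
    also have "\<dots> = ?r"
      unfolding eval_at_half_divdiff transpose_commute[of c a]
      by (cases "Poly_Mapping.lookup e a" "Poly_Mapping.lookup e c" rule: linorder_cases)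
         (simp_all add: mon_at_transpose)
    finally show ?thesis .
  qed
  then show ?thesis
    by (simp add: divdiff_def eval_at_sum sum_distrib_left)
       (simp add: eval_at_def sum_subtractf algebra_simps)
qed

lemma Mon_divdiffE:
  assumes "f \<in> Mon (divdiff a c P)"
  obtains e where "e \<in> Mon P" "Suc (mon_degree f) = mon_degree e"
    "mon_support f \<subseteq> insert a (insert c (mon_support e))"
proof -
  have "f \<in> (\<Union>e\<in>Mon P. Poly_Mapping.keys (half_divdiff a c e (Poly_Mapping.lookup P e) -
        half_divdiff c a e (Poly_Mapping.lookup P e)))"
    using assms unfolding divdiff_def Mon_def by (rule subsetD[OF keys_sum])
  then obtain e where e: "e \<in> Mon P"
      "f \<in> Poly_Mapping.keys (half_divdiff a c e (Poly_Mapping.lookup P e) -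
        half_divdiff c a e (Poly_Mapping.lookup P e))"
    by blast
  consider "f \<in> Mon (half_divdiff a c e (Poly_Mapping.lookup P e))" |
      "f \<in> Mon (half_divdiff c a e (Poly_Mapping.lookup P e))"
    using subsetD[OF keys_diff e(2)] unfolding Mon_def by blast
  then show thesis
  proof cases
    case 1
    show thesis
      by (rule that[OF e(1) mon_degree_half_divdiff[OF 1] mon_support_half_divdiff[OF 1]])
  next
    case 2
    show thesis
      using that[OF e(1) mon_degree_half_divdiff[OF 2]] mon_support_half_divdiff[OF 2] by blast
  qed
qed

text \<open>
  Among the monomials of top degree free of \<open>X\<^sub>c\<close>, only \<open>m\<close> itself can produce \<open>m / X\<^sub>a\<close>: every
  term of the geometric sum for such a monomial \<open>e\<close> contains \<open>X\<^sub>c\<close> except the last one, \<open>e / X\<^sub>a\<close>.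
  Monomials of lower degree produce terms of too low degree.
\<close>
lemma lookup_half_divdiff_single:
  assumes "mon_degree e < mon_degree m \<or> mon_degree e = mon_degree m \<and> c \<notin> mon_support e"
    and "a \<in> mon_support m" "c \<notin> mon_support m"
  shows "Poly_Mapping.lookup (half_divdiff a c e r) (m - Poly_Mapping.single a 1) = (if e = m then r else 0)"
    and "Poly_Mapping.lookup (half_divdiff c a e r) (m - Poly_Mapping.single a 1) = 0"
proof -
  let ?m = "m - Poly_Mapping.single a 1"
  have m: "m = ?m + Poly_Mapping.single a 1"
    using assms(2) by (intro diff_single_add_single[symmetric]) (simp add: mon_support_def in_keys_iff)
  then have deg: "mon_degree m = Suc (mon_degree ?m)"
    using mon_degree_add[of ?m "Poly_Mapping.single a 1"] by simp
  have "a \<noteq> c"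
    using assms by auto
  have goal: "Poly_Mapping.lookup (half_divdiff a c e r) ?m = (if e = m then r else 0) \<and>
      Poly_Mapping.lookup (half_divdiff c a e r) ?m = 0"
  proof (cases "mon_degree e < mon_degree m")
    case True
    then have "?m \<notin> Mon (half_divdiff a c e r)" "?m \<notin> Mon (half_divdiff c a e r)"
      using mon_degree_half_divdiff deg by fastforce+
    then show ?thesis
      using True by (auto simp: Mon_def in_keys_iff)
  next
    case False
    then have c: "Poly_Mapping.lookup e c = 0"
      using assms(1) by (simp add: mon_support_def in_keys_iff)
    define k where "k = Poly_Mapping.lookup e a"
    define t where "t i = e - Poly_Mapping.single a k + Poly_Mapping.single a i + Poly_Mapping.single c (k - Suc i)" for i
    have t_eq: "t i = ?m \<longleftrightarrow> Suc i = k \<and> e = m" if "i < k" for i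
    proof
      assume t: "t i = ?m"
      have "Poly_Mapping.lookup (t i) c = k - Suc i"
        using c \<open>a \<noteq> c\<close> by (simp add: t_def lookup_add lookup_minus lookup_single)
      moreover have "Poly_Mapping.lookup ?m c = 0"
        using assms(3) by (simp add: mon_support_def in_keys_iff lookup_minus)
      ultimately have i: "Suc i = k"
        using t that by simp
      have "e = e - Poly_Mapping.single a k + Poly_Mapping.single a k"
        by (simp add: diff_single_add_single k_def)
      also have "\<dots> = t i + Poly_Mapping.single a 1"
        using i by (auto simp: t_def add.assoc simp flip: single_add)
      also have "\<dots> = m"
        unfolding t using m by simp
      finally show "Suc i = k \<and> e = m"
        using i by simp
    next
      assume i: "Suc i = k \<and> e = m"
      have "t i + Poly_Mapping.single a 1 = e - Poly_Mapping.single a k + Poly_Mapping.single a k"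
        using i by (auto simp: t_def add.assoc simp flip: single_add)
      also have "\<dots> = ?m + Poly_Mapping.single a 1"
        using i m by (simp add: diff_single_add_single k_def)
      finally show "t i = ?m"
        by simp
    qed
    have k: "0 < k" if "e = m"
      using that assms(2) by (simp add: k_def mon_support_def in_keys_iff)
    have "Poly_Mapping.lookup (half_divdiff a c e r) ?m = (\<Sum>i<k. if t i = ?m then r else 0)"
      unfolding half_divdiff_def Let_def c diff_zero k_def[symmetric] t_def[symmetric]
      by (simp add: lookup_sum lookup_single when_def)
    also have "\<dots> = (\<Sum>i<k. if i = k - 1 then (if e = m then r else 0) else 0)"
    proof (rule sum.cong[OF refl])
      fix i assume "i \<in> {..<k}"
      then show "(if t i = ?m then r else 0) = (if i = k - 1 then (if e = m then r else 0) else 0)"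
        using t_eq[of i] by auto
    qed
    also have "\<dots> = (if e = m then r else 0)"
      using k by (simp add: sum.delta)
    finally show ?thesis
      using c by (simp add: half_divdiff_def)
  qed
  show "Poly_Mapping.lookup (half_divdiff a c e r) ?m = (if e = m then r else 0)"
    and "Poly_Mapping.lookup (half_divdiff c a e r) ?m = 0"
    using goal by blast+
qed

text \<open>
  The algebraic heart of the proof. Every \<open>y \<in> V\<close> is a fresh variable attached to the variable
  \<open>b y\<close> of \<open>m\<close>, and each variable of \<open>m\<close> has as many fresh variables as its exponent. Taking the
  divided difference for the pair \<open>(b y, y)\<close> keeps a polynomial that vanishes on \<open>W\<close>, because
  \<open>W\<close> is stable under the swap and the denominator is nonzero there. It lowers the degree by one,
  replaces \<open>m\<close> by \<open>m / X\<^bsub>b y\<^esub>\<close> with the same coefficient, and leaves the unused fresh variables absent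
  from the top degree. Once all of \<open>V\<close> is used up, what remains is the constant with the
  coefficient of \<open>m\<close> in \<open>P\<close> as its value. It is nonzero, so \<open>W\<close> has no points.
\<close>
lemma vanishing_on_swap_closed_set_imp_empty:
  fixes P :: "'a::idom mpol"
  assumes "finite V"
    and "m \<in> Mon P"
    and "\<And>e. e \<in> Mon P \<Longrightarrow> mon_degree e \<le> mon_degree m"
    and "\<And>e. e \<in> Mon P \<Longrightarrow> mon_degree e = mon_degree m \<Longrightarrow> mon_support e \<inter> V = {}"
    and "\<And>s. Poly_Mapping.lookup m s = card {y \<in> V. b y = s}"
    and "\<And>z y. z \<in> W \<Longrightarrow> y \<in> V \<Longrightarrow> z (b y) \<noteq> z y \<and> z \<circ> transpose (b y) y \<in> W"
    and "\<And>z. z \<in> W \<Longrightarrow> eval_at z P = 0"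
  shows "W = {}"
  using assms
proof (induction V arbitrary: P m rule: finite_induct)
  case empty
  have "m = 0"
    by (rule poly_mapping_eqI) (simp add: empty.prems(4))
  then have "Mon P = {0}"
    using empty.prems(1,2) by auto
  then have "eval_at z P = Poly_Mapping.lookup P 0" for z
    by (simp add: eval_at_def)
  moreover have "Poly_Mapping.lookup P 0 \<noteq> 0"
    using \<open>Mon P = {0}\<close> by (auto simp: Mon_def simp flip: in_keys_iff)
  ultimately show ?case
    using empty.prems(6) by auto
next
  case (insert y V)
  define s where "s = b y"
  define Q where "Q = divdiff s y P"
  define m' where "m' = m - Poly_Mapping.single s 1"
  have "0 < Poly_Mapping.lookup m s"
    unfolding insert.prems(4) s_def using insert.hyps by (auto simp: card_gt_0_iff)
  then have s: "s \<in> mon_support m"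
    by (simp add: mon_support_def in_keys_iff)
  have y: "y \<notin> mon_support e" if "e \<in> Mon P" "mon_degree e = mon_degree m" for e
    using insert.prems(3)[OF that] by blast
  have "m = m' + Poly_Mapping.single s 1"
    unfolding m'_def using \<open>0 < _\<close> by (intro diff_single_add_single[symmetric]) simp
  then have deg: "mon_degree m = Suc (mon_degree m')"
    using mon_degree_add[of m' "Poly_Mapping.single s 1"] by simp
  show ?case
  proof (rule insert.IH)
    have "Poly_Mapping.lookup Q m' = (\<Sum>e\<in>Mon P. if e = m then Poly_Mapping.lookup P e else 0)"
      unfolding Q_def divdiff_def lookup_sum
    proof (rule sum.cong[OF refl])
      fix e assume e: "e \<in> Mon P"
      have "mon_degree e < mon_degree m \<or> mon_degree e = mon_degree m \<and> y \<notin> mon_support e"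
        using insert.prems(2)[OF e] y[OF e] by linarith
      moreover have "y \<notin> mon_support m"
        using y insert.prems(1) by blast
      ultimately show "Poly_Mapping.lookup (half_divdiff s y e (Poly_Mapping.lookup P e) -
            half_divdiff y s e (Poly_Mapping.lookup P e)) m' =
          (if e = m then Poly_Mapping.lookup P e else 0)"
        using lookup_half_divdiff_single[of e m y s "Poly_Mapping.lookup P e"] s
        by (simp add: lookup_minus m'_def)
    qed
    also have "\<dots> = Poly_Mapping.lookup P m"
      using insert.prems(1) by (simp add: Mon_def)
    finally show "m' \<in> Mon Q"
      using insert.prems(1) by (simp add: Mon_def in_keys_iff)
  next
    fix f assume "f \<in> Mon Q"
    then obtain e where e: "e \<in> Mon P" "Suc (mon_degree f) = mon_degree e"
        "mon_support f \<subseteq> insert s (insert y (mon_support e))"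
      unfolding Q_def by (rule Mon_divdiffE)
    show "mon_degree f \<le> mon_degree m'"
      using insert.prems(2)[OF e(1)] e(2) deg by linarith
    assume "mon_degree f = mon_degree m'"
    then have "mon_support e \<inter> insert y V = {}"
      using insert.prems(3)[OF e(1)] e(2) deg by simp
    moreover have "s \<notin> V"
      using insert.prems(1) insert.prems(3)[of m] s by blast
    ultimately show "mon_support f \<inter> V = {}"
      using e(3) insert.hyps by blast
  next
    fix s'
    have "{y' \<in> insert y V. b y' = s'} = (if s' = s then insert y {y' \<in> V. b y' = s'} else {y' \<in> V. b y' = s'})"
      by (auto simp: s_def)
    then show "Poly_Mapping.lookup m' s' = card {y' \<in> V. b y' = s'}"
      using insert.hyps by (simp add: m'_def lookup_minus insert.prems(4) lookup_single)
  next
    fix z y' assume "z \<in> W" "y' \<in> V"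
    then show "z (b y') \<noteq> z y' \<and> z \<circ> transpose (b y') y' \<in> W"
      using insert.prems(5) by blast
  next
    fix z assume z: "z \<in> W"
    have swap: "z s \<noteq> z y" "z \<circ> transpose s y \<in> W"
      using insert.prems(5)[OF z, of y] unfolding s_def by blast+
    then show "eval_at z Q = 0"
      using eval_at_divdiff[of z s y P] insert.prems(6)[OF z] insert.prems(6)[OF swap(2)]
      by (simp add: Q_def)
  qed
qed

section \<open>Filling columns with distinct values\<close>

lemma obtain_top_subset:
  fixes \<mu> :: "'c \<Rightarrow> nat"
  assumes "finite C" "k \<le> card C"
  obtains D where "D \<subseteq> C" "card D = k" "\<And>c c'. c \<in> D \<Longrightarrow> c' \<in> C - D \<Longrightarrow> \<mu> c' \<le> \<mu> c"
proof -
  have "\<exists>D\<subseteq>C. card D = k \<and> (\<forall>c\<in>D. \<forall>c'\<in>C - D. \<mu> c' \<le> \<mu> c)"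
    using assms(2)
  proof (induction k)
    case 0
    then show ?case
      by (intro exI[of _ "{}"]) simp
  next
    case (Suc k)
    then obtain D where D: "D \<subseteq> C" "card D = k" "\<forall>c\<in>D. \<forall>c'\<in>C - D. \<mu> c' \<le> \<mu> c"
      by auto
    have "finite D"
      using D(1) assms(1) by (rule finite_subset)
    have "C - D \<noteq> {}"
      using D(1,2) Suc.prems by auto
    then have "Max (\<mu> ` (C - D)) \<in> \<mu> ` (C - D)"
      using assms(1) by (intro Max_in) auto
    then obtain c where c: "c \<in> C - D" "\<mu> c = Max (\<mu> ` (C - D))"
      by fastforce
    have "\<mu> c' \<le> \<mu> c" if "c' \<in> C - D" for c'
      unfolding c(2) using assms(1) that by (intro Max_ge) auto
    then show ?case
      using D c(1) \<open>finite D\<close> by (intro exI[of _ "insert c D"]) auto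
  qed
  then show thesis
    using that by blast
qed

text \<open>
  The existence half of the Gale--Ryser theorem, with the dominance condition replaced by a
  condition of Hall type on all sets of values, so that it does not refer to an ordering. Here \<open>\<nu> v\<close> is
  the number of columns that receive \<open>v\<close>, and \<open>\<mu> c\<close> is the capacity of column \<open>c\<close>. The values are
  placed one after the other, each one greedily in columns of largest remaining capacity.
\<close>
lemma gale_ryser:
  assumes "finite A" "finite C"
    and "\<And>S. S \<subseteq> A \<Longrightarrow> (\<Sum>v\<in>S. \<nu> v) \<le> (\<Sum>c\<in>C. min (\<mu> c) (card S))"
  obtains D where "\<And>v. v \<in> A \<Longrightarrow> D v \<subseteq> C" "\<And>v. v \<in> A \<Longrightarrow> card (D v) = \<nu> v"
    "\<And>c. c \<in> C \<Longrightarrow> card {v \<in> A. c \<in> D v} \<le> \<mu> c"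
proof -
  have "\<exists>D. (\<forall>v\<in>A. D v \<subseteq> C \<and> card (D v) = \<nu> v) \<and> (\<forall>c\<in>C. card {v \<in> A. c \<in> D v} \<le> \<mu> c)"
    using assms(1,3)
  proof (induction A arbitrary: \<mu> rule: finite_induct)
    case empty
    then show ?case
      by simp
  next
    case (insert v A)
    define C' where "C' = {c \<in> C. 0 < \<mu> c}"
    have "\<nu> v \<le> (\<Sum>c\<in>C. min (\<mu> c) 1)"
      using insert.prems[of "{v}"] by simp
    also have "\<dots> = (\<Sum>c\<in>C'. 1)"
      unfolding C'_def using assms(2) by (intro sum.mono_neutral_cong_right) auto
    finally obtain D where D: "D \<subseteq> C'" "card D = \<nu> v"
        "\<And>c c'. c \<in> D \<Longrightarrow> c' \<in> C' - D \<Longrightarrow> \<mu> c' \<le> \<mu> c"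
      using obtain_top_subset[of C' "\<nu> v" \<mu>] assms(2) by (auto simp: C'_def)
    \<comment> \<open>The capacities left after placing \<open>v\<close>; \<open>top\<close> says that the choice of \<open>D\<close> was greedy.\<close>
    define \<mu>' where "\<mu>' c = \<mu> c - (if c \<in> D then 1 else 0)" for c
    have top: "\<mu> c' \<le> \<mu> c" if "c \<in> D" "c' \<in> C - D" for c c'
      using D(3)[of c c'] that by (cases "c' \<in> C'") (auto simp: C'_def)
    have "\<exists>E. (\<forall>u\<in>A. E u \<subseteq> C \<and> card (E u) = \<nu> u) \<and> (\<forall>c\<in>C. card {u \<in> A. c \<in> E u} \<le> \<mu>' c)"
    proof (rule insert.IH)
      fix S assume S: "S \<subseteq> A"
      then have "finite S" "v \<notin> S"
        using insert.hyps by (auto intro: finite_subset)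
      show "sum \<nu> S \<le> (\<Sum>c\<in>C. min (\<mu>' c) (card S))"
      proof (cases "\<forall>c\<in>D. card S < \<mu> c")
        \<comment> \<open>All columns used for \<open>v\<close> are so large that losing one place is invisible to \<open>S\<close>.\<close>
        case True
        have "sum \<nu> S \<le> (\<Sum>c\<in>C. min (\<mu> c) (card S))"
          using S by (intro insert.prems) auto
        also have "\<dots> = (\<Sum>c\<in>C. min (\<mu>' c) (card S))"
          using True by (intro sum.cong refl) (auto simp: \<mu>'_def min_def)
        finally show ?thesis .
      next
        case False
        \<comment> \<open>Some column used for \<open>v\<close> is small, hence so are all unused ones, and the condition for
          \<open>insert v S\<close> counts the places taken by \<open>v\<close> exactly.\<close>
        then obtain c0 where c0: "c0 \<in> D" "\<mu> c0 \<le> card S"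
          by auto
        have min_eq: "min (\<mu> c) (Suc (card S)) = min (\<mu>' c) (card S) + (if c \<in> D then 1 else 0)"
          if "c \<in> C" for c
        proof (cases "c \<in> D")
          case True
          then have "0 < \<mu> c"
            using D(1) by (auto simp: C'_def)
          then show ?thesis
            using True by (cases "\<mu> c") (auto simp: \<mu>'_def min_def)
        next
          case False
          then have "\<mu> c \<le> card S"
            using top[of c0 c] c0 that by auto
          then show ?thesis
            using False by (simp add: \<mu>'_def min_def)
        qed
        have "\<nu> v + sum \<nu> S = sum \<nu> (insert v S)"
          using \<open>finite S\<close> \<open>v \<notin> S\<close> by simp
        also have "\<dots> \<le> (\<Sum>c\<in>C. min (\<mu> c) (card (insert v S)))"
          using S by (intro insert.prems) auto
        also have "\<dots> = (\<Sum>c\<in>C. min (\<mu>' c) (card S) + (if c \<in> D then 1 else 0))"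
          using \<open>finite S\<close> \<open>v \<notin> S\<close> min_eq by (intro sum.cong refl) simp
        also have "\<dots> = (\<Sum>c\<in>C. min (\<mu>' c) (card S)) + card (C \<inter> D)"
          using assms(2) by (simp add: sum.distrib sum.If_cases)
        also have "C \<inter> D = D"
          using D(1) by (auto simp: C'_def)
        finally show ?thesis
          using D(2) by simp
      qed
    qed
    then obtain E where E: "\<And>u. u \<in> A \<Longrightarrow> E u \<subseteq> C" "\<And>u. u \<in> A \<Longrightarrow> card (E u) = \<nu> u"
        "\<And>c. c \<in> C \<Longrightarrow> card {u \<in> A. c \<in> E u} \<le> \<mu>' c"
      by blast
    show ?case
    proof (intro exI[of _ "E(v := D)"] conjI ballI)
      fix u assume "u \<in> insert v A"
      then show "(E(v := D)) u \<subseteq> C" "card ((E(v := D)) u) = \<nu> u"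
        using E D insert.hyps by (auto simp: C'_def)
    next
      fix c assume c: "c \<in> C"
      have "{u \<in> insert v A. c \<in> (E(v := D)) u} =
          (if c \<in> D then insert v {u \<in> A. c \<in> E u} else {u \<in> A. c \<in> E u})"
        using insert.hyps by auto
      moreover have "0 < \<mu> c" if "c \<in> D"
        using D(1) that by (auto simp: C'_def)
      ultimately show "card {u \<in> insert v A. c \<in> (E(v := D)) u} \<le> \<mu> c"
        using E(3)[OF c] insert.hyps by (auto simp: \<mu>'_def)
    qed
  qed
  then show thesis
    using that by blast
qed

lemma card_eq_sum_card_fibers:
  assumes "finite N" "finite C" "\<beta> ` N \<subseteq> C"
  shows "card N = (\<Sum>c\<in>C. card {j \<in> N. \<beta> j = c})"
  using sum.group[OF assms, of "\<lambda>_. 1::nat"] by simp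

text \<open>
  The column filling turned into a partition of the index set into blocks of prescribed sizes, each
  of which meets every level set of \<open>g\<close> at most once. The level set of \<open>v\<close> is distributed bijectively
  over the columns that contain \<open>v\<close>. The block sizes agree with \<open>\<mu>\<close>, and do not just stay below it,
  because both families have the same sum.
\<close>
lemma obtain_blocks_separating_values:
  fixes g :: "'i \<Rightarrow> 'v" and \<mu> :: "'c \<Rightarrow> nat"
  assumes "finite N" "finite C" "(\<Sum>c\<in>C. \<mu> c) = card N"
    and "\<And>S. S \<subseteq> g ` N \<Longrightarrow> card {j \<in> N. g j \<in> S} \<le> (\<Sum>c\<in>C. min (\<mu> c) (card S))"
  obtains \<beta> where "\<beta> ` N \<subseteq> C" "\<forall>c\<in>C. card {j \<in> N. \<beta> j = c} = \<mu> c"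
    "\<forall>j\<in>N. \<forall>k\<in>N. \<beta> j = \<beta> k \<longrightarrow> g j = g k \<longrightarrow> j = k"
proof -
  define \<nu> where "\<nu> v = card {j \<in> N. g j = v}" for v
  have "sum \<nu> S = card {j \<in> N. g j \<in> S}" if "S \<subseteq> g ` N" for S
  proof -
    have "finite S"
      using that assms(1) finite_surj by blast
    then have "card {j \<in> N. g j \<in> S} = (\<Sum>v\<in>S. card {j \<in> {j \<in> N. g j \<in> S}. g j = v})"
      using assms(1) by (intro card_eq_sum_card_fibers) auto
    also have "\<dots> = sum \<nu> S"
      unfolding \<nu>_def by (intro sum.cong refl arg_cong[where f = card]) auto
    finally show ?thesis ..
  qed
  then obtain D where D: "\<And>v. v \<in> g ` N \<Longrightarrow> D v \<subseteq> C" "\<And>v. v \<in> g ` N \<Longrightarrow> card (D v) = \<nu> v"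
      "\<And>c. c \<in> C \<Longrightarrow> card {v \<in> g ` N. c \<in> D v} \<le> \<mu> c"
    using gale_ryser[of "g ` N" C \<nu> \<mu>] assms by auto
  have "\<exists>h. bij_betw h {j \<in> N. g j = v} (D v)" if "v \<in> g ` N" for v
    using D(1,2)[OF that] assms(1,2) finite_subset
    by (intro finite_same_card_bij) (auto simp: \<nu>_def)
  then obtain h where h: "\<And>v. v \<in> g ` N \<Longrightarrow> bij_betw (h v) {j \<in> N. g j = v} (D v)"
    by metis
  define \<beta> where "\<beta> j = h (g j) j" for j
  have \<beta>_in: "\<beta> j \<in> D (g j)" if "j \<in> N" for j
    using h[of "g j"] that by (auto simp: \<beta>_def bij_betw_def)
  then have "\<beta> ` N \<subseteq> C"
    using D(1) by blast
  have sep: "j = k" if "j \<in> N" "k \<in> N" "\<beta> j = \<beta> k" "g j = g k" for j k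
    using h[of "g j"] that by (auto simp: \<beta>_def bij_betw_def inj_on_def)
  have le: "card {j \<in> N. \<beta> j = c} \<le> \<mu> c" if "c \<in> C" for c
  proof -
    have "card {j \<in> N. \<beta> j = c} \<le> card {v \<in> g ` N. c \<in> D v}"
      using assms(1) sep \<beta>_in by (intro card_inj_on_le[where f = g] inj_onI) auto
    then show ?thesis
      using D(3)[OF that] by linarith
  qed
  have "(\<Sum>c\<in>C. card {j \<in> N. \<beta> j = c}) = (\<Sum>c\<in>C. \<mu> c)"
    using card_eq_sum_card_fibers[OF assms(1,2) \<open>\<beta> ` N \<subseteq> C\<close>] assms(3) by simp
  then have "card {j \<in> N. \<beta> j = c} = \<mu> c" if "c \<in> C" for c
    using sum_mono_inv[of "\<lambda>c. card {j \<in> N. \<beta> j = c}" C \<mu> c] le that assms(2) by blast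
  then show thesis
    using that \<open>\<beta> ` N \<subseteq> C\<close> sep by blast
qed

section \<open>Partitions and dominance\<close>

lemma sum_mset_le_sum_list_take:
  fixes \<kappa> :: "nat list"
  assumes "sorted_wrt (\<ge>) \<kappa>" "A \<subseteq># mset \<kappa>"
  shows "sum_mset A \<le> sum_list (take (size A) \<kappa>)"
  using assms
proof (induction \<kappa> arbitrary: A)
  case Nil
  then show ?case
    by simp
next
  case (Cons a \<kappa>)
  show ?case
  proof (cases "A = {#}")
    case False
    \<comment> \<open>The element of \<open>A\<close> to be compared with the largest entry \<open>a\<close>; it is \<open>a\<close> itself when possible.\<close>
    then obtain b where b: "b \<in># A" "a \<in># A \<longrightarrow> b = a"
      by (cases "a \<in># A") auto
    have "b \<le> a"
      using b Cons.prems mset_subset_eqD[OF Cons.prems(2) b(1)] by auto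
    have "A - {#b#} \<subseteq># mset \<kappa>"
    proof (cases "a \<in># A")
      case True
      then show ?thesis
        using Cons.prems(2) b(2) by (simp add: subset_eq_diff_conv)
    next
      case False
      then have "A \<subseteq># mset \<kappa>"
        using mset_subset_eq_count[OF Cons.prems(2)]
        by (intro mset_subset_eqI) (metis count_add_mset mset.simps(2) not_in_iff zero_le)
      then show ?thesis
        using diff_subset_eq_self subset_mset.order_trans by blast
    qed
    then have "sum_mset (A - {#b#}) \<le> sum_list (take (size (A - {#b#})) \<kappa>)"
      using Cons by simp
    moreover have "A = add_mset b (A - {#b#})"
      using b by simp
    ultimately show ?thesis
      using \<open>b \<le> a\<close> by (metis add_mono size_add_mset sum_list.Cons sum_mset.add_mset take_Suc_Cons)
  qed simp
qed

lemma length_dual_partition: "length (dual_partition \<mu>) = (if \<mu> = [] then 0 else hd \<mu>)"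
  by (simp add: dual_partition_def)

text \<open>
  Counting the boxes in the first \<open>k\<close> columns of the Young diagram of \<open>\<mu>\<close> row by row.
\<close>
lemma sum_list_take_dual_partition:
  assumes "k \<le> length (dual_partition \<mu>)"
  shows "sum_list (take k (dual_partition \<mu>)) = (\<Sum>e\<leftarrow>\<mu>. min e k)"
proof -
  have "take k (dual_partition \<mu>) = map (\<lambda>i. card {j. j < length \<mu> \<and> \<mu> ! j \<ge> i}) [1..<Suc k]"
    using assms by (simp add: dual_partition_def take_map del: upt_Suc)
  then have "sum_list (take k (dual_partition \<mu>)) = (\<Sum>i\<in>{1..<Suc k}. card {j. j < length \<mu> \<and> \<mu> ! j \<ge> i})"
    by (simp only: interv_sum_list_conv_sum_set_nat set_upt)
  also have "\<dots> = (\<Sum>i\<in>{1..<Suc k}. \<Sum>j<length \<mu>. if i \<le> \<mu> ! j then 1 else 0)"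
    by (intro sum.cong refl) (auto simp: sum.If_cases Int_def lessThan_def)
  also have "\<dots> = (\<Sum>j<length \<mu>. \<Sum>i\<in>{1..<Suc k}. if i \<le> \<mu> ! j then 1 else 0)"
    by (rule sum.swap)
  also have "\<dots> = (\<Sum>j<length \<mu>. min (\<mu> ! j) k)"
  proof (rule sum.cong[OF refl])
    fix j
    have set_eq: "{1..<Suc k} \<inter> {i. i \<le> \<mu> ! j} = {1..min (\<mu> ! j) k}"
      by auto
    show "(\<Sum>i\<in>{1..<Suc k}. if i \<le> \<mu> ! j then 1 else 0) = min (\<mu> ! j) k"
      unfolding sum.If_cases[OF finite_atLeastLessThan] set_eq by simp
  qed
  also have "\<dots> = (\<Sum>e\<leftarrow>\<mu>. min e k)"
    by (simp add: sum_list_sum_nth atLeast0LessThan)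
  finally show ?thesis .
qed

text \<open>
  Dominance by the dual partition gives the condition of Hall type: the largest sum of \<open>k\<close> parts
  of \<open>\<kappa>\<close> is that of its first \<open>k\<close> parts. If \<open>k\<close> exceeds the length of the dual partition, dominance
  says nothing, but then the right-hand side is all of \<open>n\<close>.
\<close>
lemma sum_mset_le_of_dominated_by_dual:
  assumes "is_partition n \<kappa>" "is_partition n \<mu>" "\<kappa> \<unlhd> dual_partition \<mu>" "A \<subseteq># mset \<kappa>"
  shows "sum_mset A \<le> (\<Sum>e\<leftarrow>\<mu>. min e (size A))"
proof (cases "size A \<le> length (dual_partition \<mu>)")
  case True
  have "size A \<le> length \<kappa>"
    using size_mset_mono[OF assms(4)] by simp
  have "sum_mset A \<le> sum_list (take (size A) \<kappa>)"
    using assms by (intro sum_mset_le_sum_list_take) (auto simp: is_partition_def)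
  also have "\<dots> \<le> sum_list (take (size A) (dual_partition \<mu>))"
    using assms(3) True \<open>size A \<le> length \<kappa>\<close>
    by (cases "A = {#}") (simp_all add: dominated_by_def Suc_le_eq nonempty_has_size)
  also have "\<dots> = (\<Sum>e\<leftarrow>\<mu>. min e (size A))"
    by (rule sum_list_take_dual_partition[OF True])
  finally show ?thesis .
next
  case False
  have "e \<le> size A" if "e \<in> set \<mu>" for e
    using that False assms(2) by (cases \<mu>) (auto simp: length_dual_partition is_partition_def)
  then have "(\<Sum>e\<leftarrow>\<mu>. min e (size A)) = sum_list \<mu>"
    by (simp add: min_absorb1 cong: map_cong)
  also have "\<dots> = sum_mset (mset \<kappa>)"
    using assms(1,2) by (simp add: is_partition_def sum_mset_sum_list)
  also have "mset \<kappa> = A + (mset \<kappa> - A)"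
    using assms(4) by simp
  finally show ?thesis
    by simp
qed

lemma mset_mon_exponents:
  "mset (mon_exponents m) = image_mset (Poly_Mapping.lookup m) (mset_set (mon_support m))"
  by (simp add: mon_exponents_def mon_support_def flip: mset_set_set)

lemma sorted_wrt_ge_rev_sort: "sorted_wrt (\<ge>) (rev (sort l))" for l :: "nat list"
  by (simp add: sorted_wrt_rev)

lemma mon_partition_is_partition:
  assumes "mon_degree m + mon_weight m \<le> n"
  shows "is_partition n (mon_partition n m)"
proof -
  have "sum_list (mon_exponents m) = mon_degree m"
    by (simp add: mset_mon_exponents mon_degree_def flip: sum_mset_sum_list sum_unfold_sum_mset)
  moreover have "length (mon_exponents m) = mon_weight m"
    by (simp add: mon_exponents_def mon_weight_def mon_support_def)
  moreover have "sorted_wrt (\<ge>) (mon_exponents m)"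
    unfolding mon_exponents_def by (rule sorted_wrt_ge_rev_sort)
  moreover have "sorted_wrt (\<ge>) (replicate k (1::nat))" for k
    by (induction k) auto
  ultimately show ?thesis
    using assms
    by (simp add: is_partition_def mon_partition_def sorted_wrt_append sorted_wrt_map
        sum_list_Suc sum_list_replicate) auto
qed

lemma mset_orbit_type: "mset (orbit_type x) = image_mset (count_list x) (mset_set (set x))"
  by (simp add: orbit_type_def mset_set_set[symmetric])

lemma orbit_type_is_partition: "is_partition (length x) (orbit_type x)"
proof -
  have "sum_list (orbit_type x) = (\<Sum>v\<in>set x. count_list x v)"
    by (simp add: mset_orbit_type flip: sum_mset_sum_list sum_unfold_sum_mset)
  then show ?thesis
    using sorted_wrt_ge_rev_sort[of "map (count_list x) (remdups x)"]
    by (auto simp: is_partition_def orbit_type_def sum_count_set count_list_0_iff intro: Nat.gr0I)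
qed

text \<open>
  Provides the fresh variables: disjoint subsets of \<open>N\<close> of sizes \<open>f s\<close>, described by their union \<open>V\<close>
  and the label of each element.
\<close>
lemma obtain_labelled_subset:
  assumes "finite K" "finite N" "(\<Sum>s\<in>K. f s) \<le> card N"
  obtains V b where "V \<subseteq> N" "b ` V \<subseteq> K" "\<forall>s\<in>K. card {y \<in> V. b y = s} = f s"
proof -
  have "\<exists>V b. V \<subseteq> N \<and> b ` V \<subseteq> K \<and> (\<forall>s\<in>K. card {y \<in> V. b y = s} = f s)"
    using assms
  proof (induction K arbitrary: N rule: finite_induct)
    case empty
    then show ?case
      by (intro exI[of _ "{}"]) simp
  next
    case (insert s K)
    then have "f s \<le> card N"
      by simp
    then obtain T where T: "T \<subseteq> N" "card T = f s" "finite T"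
      by (rule obtain_subset_with_card_n)
    have "sum f K \<le> card (N - T)"
      using insert.prems insert.hyps T by (simp add: card_Diff_subset)
    then obtain V b where V: "V \<subseteq> N - T" "b ` V \<subseteq> K" "\<forall>s\<in>K. card {y \<in> V. b y = s} = f s"
      using insert.IH[of "N - T"] insert.prems(1) by auto
    let ?b = "\<lambda>y. if y \<in> T then s else b y"
    have fibre_s: "{y \<in> T \<union> V. ?b y = s} = T"
    proof -
      have "b y \<noteq> s" if "y \<in> V" for y
        using V(2) that insert.hyps(2) by blast
      then show ?thesis
        by auto
    qed
    have fibre: "{y \<in> T \<union> V. ?b y = s'} = {y \<in> V. b y = s'}" if "s' \<in> K" for s'
    proof -
      have "s' \<noteq> s" "V \<inter> T = {}"
        using V(1) that insert.hyps(2) by blast+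
      then show ?thesis
        by auto
    qed
    have "card {y \<in> T \<union> V. ?b y = s'} = f s'" if "s' \<in> insert s K" for s'
    proof (cases "s' = s")
      case True
      then show ?thesis
        unfolding True fibre_s using T(2) by simp
    next
      case False
      then have "s' \<in> K"
        using that by simp
      then show ?thesis
        unfolding fibre[OF \<open>s' \<in> K\<close>] using V(3) by blast
    qed
    moreover have "T \<union> V \<subseteq> N"
      using T(1) V(1) by blast
    moreover have "?b ` (T \<union> V) \<subseteq> insert s K"
      using V(2) by (simp add: image_subset_iff) blast
    ultimately show ?case
      by (intro exI[of _ "T \<union> V"] exI[of _ ?b] conjI ballI)
  qed
  then show thesis
    using that by blast
qed

section \<open>Orbits and zero sets of symmetric ideals\<close>

lemma mpol_support_symmetric_ideal:
  assumes "symmetric_ideal n I" "P \<in> I"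
  shows "mpol_support P \<subseteq> {..<n}"
  using assms ideal.Icarr[of I "mpol_ring n" P] by (auto simp: symmetric_ideal_def mpol_ring_def)

lemma eval_at_permuted_zero:
  assumes "symmetric_ideal n I" "P \<in> I" "x \<in> zero_set n I" "\<sigma> permutes {..<n}"
  shows "eval_at ((!) x \<circ> \<sigma>) P = 0"
  using assms by (simp add: symmetric_ideal_def zero_set_def mpol_eval_eq_eval_at flip: eval_at_rename_vars)

lemma zero_set_mset_cong:
  assumes "symmetric_ideal n I" "x \<in> zero_set n I" "mset y = mset x"
  shows "y \<in> zero_set n I"
proof -
  obtain \<sigma> where \<sigma>: "\<sigma> permutes {..<length x}" "permute_list \<sigma> x = y"
    using mset_eq_permutation[OF assms(3)] .
  have "length x = n"
    using assms(2) by (simp add: zero_set_def)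
  have "mpol_eval y P = 0" if "P \<in> I" for P
  proof -
    have "mpol_eval y P = eval_at ((!) x \<circ> \<sigma>) P"
      unfolding mpol_eval_eq_eval_at
    proof (rule eval_at_cong)
      fix j assume "j \<in> mpol_support P"
      then have "j < length x"
        using mpol_support_symmetric_ideal[OF assms(1) that] \<open>length x = n\<close> by auto
      then show "y ! j = ((!) x \<circ> \<sigma>) j"
        unfolding \<sigma>(2)[symmetric] by (simp add: permute_list_nth[OF \<sigma>(1)])
    qed
    then show ?thesis
      using eval_at_permuted_zero[OF assms(1) that assms(2)] \<sigma>(1) \<open>length x = n\<close> by simp
  qed
  then show ?thesis
    using mset_eq_length[OF assms(3)] \<open>length x = n\<close> by (simp add: zero_set_def)
qed

lemma Sn_orbit_eq: "Sn_orbit x = {y. mset y = mset x}"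
proof (intro equalityI subsetI)
  fix y assume "y \<in> {y. mset y = mset x}"
  then have "mset y = mset x"
    by simp
  then obtain \<sigma> where "\<sigma> permutes {..<length x}" "permute_list \<sigma> x = y"
    by (rule mset_eq_permutation)
  then show "y \<in> Sn_orbit x"
    by (auto simp: Sn_orbit_def)
qed (auto simp: Sn_orbit_def)

lemma spread_map: "spread \<nu> (map f l) = map f (spread \<nu> l)"
  unfolding spread_def
proof (induction \<nu> arbitrary: l)
  case (Cons a \<nu>)
  then show ?case
    by (cases l) simp_all
qed simp

lemma length_spread: "length \<nu> = length l \<Longrightarrow> length (spread \<nu> l) = sum_list \<nu>"
  unfolding spread_def by (induction \<nu> l rule: list_induct2) simp_all

lemma mpol_eval_merge_vars:
  assumes "length y = length \<nu>" "mpol_support P \<subseteq> {..<sum_list \<nu>}"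
  shows "mpol_eval y (merge_vars \<nu> P) = mpol_eval (spread \<nu> y) P"
  unfolding mpol_eval_eq_eval_at merge_vars_def eval_at_rename_vars
proof (rule eval_at_cong)
  fix j assume "j \<in> mpol_support P"
  then have j: "j < length (spread \<nu> [0..<length \<nu>])"
    using assms(2) by (auto simp: length_spread)
  have "spread \<nu> y = map ((!) y) (spread \<nu> [0..<length \<nu>])"
    unfolding assms(1)[symmetric] spread_map[symmetric] map_nth ..
  then show "((!) y \<circ> (!) (spread \<nu> [0..<length \<nu>])) j = spread \<nu> y ! j"
    using j by simp
qed

lemma mset_spread_map_count:
  assumes "distinct y"
  shows "mset (spread (map f y) y) = (\<Sum>v\<in>set y. replicate_mset (f v) v)"
  using assms by (induction y) (simp_all add: spread_def)

text \<open>
  Every point is a permutation of a point of the form \<open>spread \<nu> y\<close> for its own orbit type \<open>\<nu>\<close>: take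
  for \<open>y\<close> the distinct coordinates in the order of decreasing multiplicity.
\<close>
lemma obtain_spread_orbit_type:
  obtains y where "length y = length (orbit_type x)" "mset (spread (orbit_type x) y) = mset x"
proof
  let ?y = "rev (sort_key (count_list x) (remdups x))"
  have "sort (map (count_list x) (remdups x)) = map (count_list x) (sort_key (count_list x) (remdups x))"
    by (rule properties_for_sort) simp_all
  then have map_y: "orbit_type x = map (count_list x) ?y"
    by (simp add: orbit_type_def rev_map)
  then show "length ?y = length (orbit_type x)"
    by simp
  have "mset (spread (orbit_type x) ?y) = (\<Sum>v\<in>set x. replicate_mset (count (mset x) v) v)"
    unfolding map_y by (subst mset_spread_map_count) (simp_all add: count_mset)
  also have "\<dots> = mset x"
    by (rule multiset_eqI) (simp add: count_sum count_mset)
  finally show "mset (spread (orbit_type x) ?y) = mset x" .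
qed

section \<open>Orbit types of zeros\<close>

lemma count_image_mset_set:
  assumes "finite N"
  shows "count (image_mset \<beta> (mset_set N)) c = card {j \<in> N. \<beta> j = c}"
  using assms by (simp add: count_image_mset' eq_commute)

lemma card_indices_in_eq_sum_mset:
  assumes "S \<subseteq> set x"
  shows "card {j \<in> {..<length x}. x ! j \<in> S} = sum_mset (image_mset (count_list x) (mset_set S))"
proof -
  have "finite S"
    using assms by (rule finite_subset) simp
  then have "card {j \<in> {..<length x}. x ! j \<in> S} =
      (\<Sum>v\<in>S. card {j \<in> {j \<in> {..<length x}. x ! j \<in> S}. x ! j = v})"
    by (intro card_eq_sum_card_fibers) auto
  also have "\<dots> = (\<Sum>v\<in>S. count_list x v)"
  proof (rule sum.cong[OF refl])
    fix v assume "v \<in> S"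
    then have "{j \<in> {j \<in> {..<length x}. x ! j \<in> S}. x ! j = v} = {j. j < length x \<and> v = x ! j}"
      by auto
    then show "card {j \<in> {j \<in> {..<length x}. x ! j \<in> S}. x ! j = v} = count_list x v"
      by (simp add: count_list_eq_length_filter length_filter_conv_card)
  qed
  finally show ?thesis
    by (simp add: sum_unfold_sum_mset)
qed

lemma sum_list_map_mon_partition:
  "(\<Sum>e\<leftarrow>mon_partition n m. g e) =
     (\<Sum>s\<in>mon_support m. g (Poly_Mapping.lookup m s + 1)) + (n - mon_degree m - mon_weight m) * g 1"
  for g :: "nat \<Rightarrow> nat"
proof -
  have "(\<Sum>e\<leftarrow>mon_exponents m. g (e + 1)) =
      sum_mset (image_mset (\<lambda>e. g (e + 1)) (mset (mon_exponents m)))"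
    by (simp flip: sum_mset_sum_list)
  also have "\<dots> = (\<Sum>s\<in>mon_support m. g (Poly_Mapping.lookup m s + 1))"
    by (simp add: mset_mon_exponents sum_unfold_sum_mset multiset.map_comp o_def)
  finally show ?thesis
    by (simp add: mon_partition_def o_def sum_list_replicate)
qed

text \<open>
  The variables are divided into blocks: each variable of \<open>m\<close> together with as many fresh variables,
  outside \<open>S\<close>, as its exponent, and every remaining variable alone. A block is named by its only
  element outside \<open>V\<close>, so indices in \<open>V\<close> name empty blocks. The nonzero block sizes are the
  parts of \<open>\<mu>(m)\<close>; this is expressed by sums of functions that vanish at 0.
\<close>
lemma obtain_block_map:
  assumes "mon_support m \<subseteq> S" "S \<subseteq> {..<n}" "card S + mon_degree m \<le> n"
  obtains V b where "V \<subseteq> {..<n}" "V \<inter> S = {}" "b ` V \<subseteq> mon_support m"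
    "\<forall>s. Poly_Mapping.lookup m s = card {y \<in> V. b y = s}"
    "\<forall>g. g 0 = 0 \<longrightarrow> (\<Sum>c<n. g (card {j \<in> {..<n}. (if j \<in> V then b j else j) = c})) =
       (\<Sum>e\<leftarrow>mon_partition n m. g e :: nat)"
proof -
  let ?K = "mon_support m"
  have "finite S"
    using assms(2) by (rule finite_subset) simp
  have "finite ?K"
    by (simp add: mon_support_def)
  have le: "sum (Poly_Mapping.lookup m) ?K \<le> card ({..<n} - S)"
    using assms(2,3) \<open>finite S\<close> by (simp add: card_Diff_subset mon_degree_def)
  obtain V b where V: "V \<subseteq> {..<n} - S" "b ` V \<subseteq> ?K"
      and card_V: "\<forall>s\<in>?K. card {y \<in> V. b y = s} = Poly_Mapping.lookup m s"
    by (rule obtain_labelled_subset[OF \<open>finite ?K\<close> finite_Diff[OF finite_lessThan] le])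
  have "finite V"
    using V(1) by (rule finite_subset) simp
  have disj: "V \<inter> ?K = {}"
    using V(1) assms(1) by blast
  define \<beta> where "\<beta> j = (if j \<in> V then b j else j)" for j
  define R where "R = {..<n} - ?K - V"
  have "card V = mon_degree m"
    using card_eq_sum_card_fibers[OF \<open>finite V\<close> \<open>finite ?K\<close> V(2)] card_V by (simp add: mon_degree_def)
  moreover have "card ({..<n} - ?K) = n - card ?K"
    using assms(1,2) \<open>finite ?K\<close> by (subst card_Diff_subset) auto
  moreover have "V \<subseteq> {..<n} - ?K"
    using V(1) assms(1) by blast
  ultimately have card_R: "card R = n - mon_degree m - mon_weight m"
    using \<open>finite V\<close> by (simp add: R_def card_Diff_subset mon_weight_def)
  have fibre_K: "card {j \<in> {..<n}. \<beta> j = c} = Poly_Mapping.lookup m c + 1" if "c \<in> ?K" for c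
  proof -
    have "{j \<in> {..<n}. \<beta> j = c} = insert c {y \<in> V. b y = c}"
    proof -
      have "c < n" "c \<notin> V"
        using that assms(1,2) disj by auto
      then show ?thesis
        using V(1) by (auto simp: \<beta>_def split: if_splits)
    qed
    moreover have "c \<notin> V"
      using that disj by blast
    ultimately show ?thesis
      using \<open>finite V\<close> bspec[OF card_V that] by simp
  qed
  have fibre_V: "card {j \<in> {..<n}. \<beta> j = c} = 0" if "c \<in> V" for c
  proof -
    have "\<beta> j \<noteq> c" for j
      using that V(2) disj by (auto simp: \<beta>_def)
    then show ?thesis
      by simp
  qed
  have fibre_R: "card {j \<in> {..<n}. \<beta> j = c} = 1" if "c \<in> R" for c
  proof -
    have "c \<notin> V" "c \<notin> b ` V" "c < n"
      using that V(2) by (auto simp: R_def)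
    then have "{j \<in> {..<n}. \<beta> j = c} = {c}"
      by (auto simp: \<beta>_def)
    then show ?thesis
      by simp
  qed
  show thesis
  proof (rule that)
    show "V \<subseteq> {..<n}" "V \<inter> S = {}" "b ` V \<subseteq> ?K"
      using V by auto
    show "\<forall>s. Poly_Mapping.lookup m s = card {y \<in> V. b y = s}"
    proof
      fix s
      show "Poly_Mapping.lookup m s = card {y \<in> V. b y = s}"
      proof (cases "s \<in> ?K")
        case False
        then have "{y \<in> V. b y = s} = {}"
          using V(2) by blast
        then have "card {y \<in> V. b y = s} = 0"
          by (simp only: card.empty)
        then show ?thesis
          using False by (simp add: mon_support_def in_keys_iff)
      qed (use card_V in simp)
    qed
  next
    show "\<forall>g. g 0 = 0 \<longrightarrow> (\<Sum>c<n. g (card {j \<in> {..<n}. (if j \<in> V then b j else j) = c})) =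
        (\<Sum>e\<leftarrow>mon_partition n m. g e :: nat)"
    proof (intro allI impI)
      fix g :: "nat \<Rightarrow> nat" assume "g 0 = 0"
      let ?h = "\<lambda>c. g (card {j \<in> {..<n}. \<beta> j = c})"
      have "{..<n} = ?K \<union> (V \<union> R)"
        using V(1) assms(1,2) by (auto simp: R_def)
      moreover have "?K \<inter> (V \<union> R) = {}" "V \<inter> R = {}" "finite R"
        using disj by (auto simp: R_def)
      ultimately have "sum h {..<n} = sum h ?K + (sum h V + sum h R)" for h :: "nat \<Rightarrow> nat"
        using \<open>finite ?K\<close> \<open>finite V\<close> by (simp add: sum.union_disjoint)
      then have "(\<Sum>c<n. ?h c) = sum ?h ?K + (sum ?h V + sum ?h R)" .
      also have "sum ?h ?K = (\<Sum>s\<in>?K. g (Poly_Mapping.lookup m s + 1))"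
        by (intro sum.cong refl) (simp only: fibre_K)
      also have "sum ?h V = 0"
        using \<open>g 0 = 0\<close> by (intro sum.neutral ballI) (simp only: fibre_V)
      also have "sum ?h R = card R * g 1"
        by (simp only: fibre_R sum_constant cong: sum.cong) simp
      finally show "(\<Sum>c<n. g (card {j \<in> {..<n}. (if j \<in> V then b j else j) = c})) =
          (\<Sum>e\<leftarrow>mon_partition n m. g e)"
        by (simp add: sum_list_map_mon_partition card_R \<beta>_def)
    qed
  qed
qed

text \<open>
  If the orbit type of \<open>x\<close> is dominated by the dual of the partition formed by the block sizes, then
  the Gale--Ryser condition holds, so the coordinates of \<open>x\<close> can be permuted to be pairwise distinct on
  every block. The filling yields blocks of the right sizes, and a permutation carries the given
  blocks to these.
\<close>
lemma obtain_permutation_separating_blocks: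
  fixes \<beta> :: "nat \<Rightarrow> nat"
  assumes "\<beta> ` {..<n} \<subseteq> {..<n}" "length x = n"
    and "is_partition n \<mu>" "orbit_type x \<unlhd> dual_partition \<mu>"
    and "\<forall>g. g 0 = 0 \<longrightarrow> (\<Sum>c<n. g (card {j \<in> {..<n}. \<beta> j = c})) = (\<Sum>e\<leftarrow>\<mu>. g e :: nat)"
  obtains \<pi> where "\<pi> permutes {..<n}"
    "\<forall>j<n. \<forall>k<n. \<beta> j = \<beta> k \<longrightarrow> x ! \<pi> j = x ! \<pi> k \<longrightarrow> j = k"
proof -
  define \<mu>' where "\<mu>' c = card {j \<in> {..<n}. \<beta> j = c}" for c
  have sum_\<mu>': "(\<Sum>c<n. \<mu>' c) = card {..<n}"
    unfolding \<mu>'_def using assms(1) by (intro card_eq_sum_card_fibers[symmetric]) auto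
  have hall: "card {j \<in> {..<n}. x ! j \<in> S} \<le> (\<Sum>c<n. min (\<mu>' c) (card S))"
    if S: "S \<subseteq> (!) x ` {..<n}" for S
  proof -
    have "S \<subseteq> set x"
      using S assms(2) by auto
    let ?A = "image_mset (count_list x) (mset_set S)"
    have "?A \<subseteq># mset (orbit_type x)"
      unfolding mset_orbit_type using \<open>S \<subseteq> set x\<close>
      by (intro image_mset_subseteq_mono subset_imp_msubset_mset_set) auto
    then have "sum_mset ?A \<le> (\<Sum>e\<leftarrow>\<mu>. min e (size ?A))"
      using orbit_type_is_partition[of x] assms(2,3,4)
      by (intro sum_mset_le_of_dominated_by_dual) auto
    moreover have "(\<Sum>c<n. min (\<mu>' c) (card S)) = (\<Sum>e\<leftarrow>\<mu>. min e (card S))"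
      unfolding \<mu>'_def by (rule assms(5)[rule_format]) simp
    ultimately show ?thesis
      using card_indices_in_eq_sum_mset[OF \<open>S \<subseteq> set x\<close>] assms(2) by simp
  qed
  obtain \<gamma> where \<gamma>: "\<gamma> ` {..<n} \<subseteq> {..<n}"
      "\<forall>c\<in>{..<n}. card {j \<in> {..<n}. \<gamma> j = c} = \<mu>' c"
      "\<forall>j\<in>{..<n}. \<forall>k\<in>{..<n}. \<gamma> j = \<gamma> k \<longrightarrow> x ! j = x ! k \<longrightarrow> j = k"
    by (rule obtain_blocks_separating_values[OF finite_lessThan finite_lessThan sum_\<mu>' hall])
  have same_fibres: "image_mset \<beta> (mset_set {..<n}) = image_mset \<gamma> (mset_set {..<n})"
  proof (rule multiset_eqI)
    fix c
    show "count (image_mset \<beta> (mset_set {..<n})) c = count (image_mset \<gamma> (mset_set {..<n})) c"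
    proof (cases "c < n")
      case True
      then show ?thesis
        using \<gamma>(2) by (simp add: count_image_mset_set \<mu>'_def)
    next
      case False
      then have "{j \<in> {..<n}. \<beta> j = c} = {}" "{j \<in> {..<n}. \<gamma> j = c} = {}"
        using assms(1) \<gamma>(1) by auto
      then show ?thesis
        by (simp only: count_image_mset_set[OF finite_lessThan])
    qed
  qed
  obtain \<pi> where \<pi>: "\<pi> permutes {..<n}" "\<forall>j\<in>{..<n}. \<beta> j = \<gamma> (\<pi> j)"
    by (rule image_mset_eq_implies_permutes[OF finite_lessThan same_fibres])
  show thesis
  proof (rule that[OF \<pi>(1)], intro allI impI)
    fix j k assume "j < n" "k < n" "\<beta> j = \<beta> k" "x ! \<pi> j = x ! \<pi> k"
    then have "\<pi> j = \<pi> k"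
      using \<pi>(2) permutes_in_image[OF \<pi>(1)] bspec[OF bspec[OF \<gamma>(3)], of "\<pi> j" "\<pi> k"] by simp
    then show "j = k"
      using permutes_inj[OF \<pi>(1)] by (simp add: inj_eq)
  qed
qed

text \<open>
  The set \<open>W\<close> consists of the rearrangements of \<open>x\<close> with distinct coordinates on each block. \<open>P\<close>
  vanishes on it because \<open>I\<close> is symmetric, and swaps within a block preserve it. By the divided
  difference argument it is empty, whereas dominance would provide a point of it.
\<close>
lemma zero_orbit_type_not_dominated:
  fixes P :: "'a::field mpol"
  assumes "symmetric_ideal n I" "P \<in> I" "m \<in> Mon P"
    and "\<And>e. e \<in> Mon P \<Longrightarrow> mon_degree e \<le> mon_degree m"
    and "S = (\<Union>e\<in>{e \<in> Mon P. mon_degree e = mon_degree m}. mon_support e)"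
    and "card S + mon_degree m \<le> n"
    and "x \<in> zero_set n I"
  shows "\<not> orbit_type x \<unlhd> dual_partition (mon_partition n m)"
proof
  assume dom: "orbit_type x \<unlhd> dual_partition (mon_partition n m)"
  have "length x = n"
    using assms(7) by (simp add: zero_set_def)
  have "S \<subseteq> mpol_support P"
    unfolding assms(5) mpol_support_def by blast
  also have "\<dots> \<subseteq> {..<n}"
    using assms(1,2) by (rule mpol_support_symmetric_ideal)
  finally have S: "S \<subseteq> {..<n}" .
  have m: "mon_support m \<subseteq> S"
    using assms(3,5) by blast
  obtain V b where V: "V \<subseteq> {..<n}" "V \<inter> S = {}" "b ` V \<subseteq> mon_support m"
      and card_V: "\<forall>s. Poly_Mapping.lookup m s = card {y \<in> V. b y = s}"
      and fibres: "\<forall>g. g 0 = 0 \<longrightarrow> (\<Sum>c<n. g (card {j \<in> {..<n}. (if j \<in> V then b j else j) = c})) =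
        (\<Sum>e\<leftarrow>mon_partition n m. g e :: nat)"
    by (rule obtain_block_map[OF m S assms(6)])
  define \<beta> where "\<beta> j = (if j \<in> V then b j else j)" for j
  have "card (mon_support m) \<le> card S"
    using m S by (intro card_mono) (auto intro: finite_subset)
  then have part: "is_partition n (mon_partition n m)"
    using assms(6) by (intro mon_partition_is_partition) (simp add: mon_weight_def)
  have \<beta>_in: "\<beta> ` {..<n} \<subseteq> {..<n}"
    using V(3) m S by (auto simp: \<beta>_def)
  obtain \<pi> where \<pi>: "\<pi> permutes {..<n}"
      "\<forall>j<n. \<forall>k<n. \<beta> j = \<beta> k \<longrightarrow> x ! \<pi> j = x ! \<pi> k \<longrightarrow> j = k"
    by (rule obtain_permutation_separating_blocks[OF \<beta>_in \<open>length x = n\<close> part dom fibres[folded \<beta>_def]])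
  define W where "W = {(!) x \<circ> \<sigma> | \<sigma>. \<sigma> permutes {..<n} \<and>
    (\<forall>j<n. \<forall>k<n. \<beta> j = \<beta> k \<longrightarrow> x ! \<sigma> j = x ! \<sigma> k \<longrightarrow> j = k)}"
  have "W = {}"
  proof (rule vanishing_on_swap_closed_set_imp_empty[where V = V and b = b and m = m and P = P])
    show "finite V"
      using V(1) by (rule finite_subset) simp
    show "mon_support e \<inter> V = {}" if "e \<in> Mon P" "mon_degree e = mon_degree m" for e
      using that V(2) assms(5) by blast
  next
    fix z y assume "z \<in> W" "y \<in> V"
    then obtain \<sigma> where z: "z = (!) x \<circ> \<sigma>" and \<sigma>: "\<sigma> permutes {..<n}"
        and sep: "\<And>j k. j < n \<Longrightarrow> k < n \<Longrightarrow> \<beta> j = \<beta> k \<Longrightarrow> x ! \<sigma> j = x ! \<sigma> k \<Longrightarrow> j = k"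
      by (auto simp: W_def)
    have "b y \<in> S"
      using \<open>y \<in> V\<close> V(3) m by blast
    then have b: "y < n" "b y < n" "b y \<notin> V"
      using \<open>y \<in> V\<close> V(1,2) S by blast+
    then have \<beta>: "\<beta> y = \<beta> (b y)" "b y \<noteq> y"
      using \<open>y \<in> V\<close> by (auto simp: \<beta>_def)
    then have "z (b y) \<noteq> z y"
      using sep[of y "b y"] b by (auto simp: z)
    moreover have "z \<circ> transpose (b y) y \<in> W"
    proof -
      let ?\<tau> = "transpose (b y) y"
      have \<tau>: "?\<tau> permutes {..<n}"
        using b by (intro permutes_swap_id) auto
      have "j = k" if "j < n" "k < n" "\<beta> j = \<beta> k" "x ! \<sigma> (?\<tau> j) = x ! \<sigma> (?\<tau> k)" for j k
      proof -
        have "\<beta> (?\<tau> i) = \<beta> i" for i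
          using \<beta>(1) by (auto simp: transpose_def)
        then have "?\<tau> j = ?\<tau> k"
          using that permutes_in_image[OF \<tau>] sep[of "?\<tau> j" "?\<tau> k"] by simp
        then show ?thesis
          by (rule injD[OF permutes_inj[OF \<tau>]])
      qed
      then show ?thesis
        unfolding W_def z using permutes_compose[OF \<tau> \<sigma>]
        by (auto simp: o_assoc intro!: exI[of _ "\<sigma> \<circ> ?\<tau>"])
    qed
    ultimately show "z (b y) \<noteq> z y \<and> z \<circ> transpose (b y) y \<in> W" ..
  next
    fix z assume "z \<in> W"
    then show "eval_at z P = 0"
      using eval_at_permuted_zero[OF assms(1,2,7)] by (auto simp: W_def)
  qed (use assms(3,4) card_V in auto)
  moreover have "(!) x \<circ> \<pi> \<in> W"
    using \<pi> by (auto simp: W_def)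
  ultimately show False
    by blast
qed

lemma Mon_hom_component: "Mon (hom_component h P) = {e \<in> Mon P. mon_degree e = h}"
proof -
  have "Poly_Mapping.lookup (hom_component h P) e =
      (if e \<in> Mon P \<and> mon_degree e = h then Poly_Mapping.lookup P e else 0)" for e
    by (auto simp: hom_component_def lookup_sum lookup_single when_def Mon_def)
  then show ?thesis
    by (auto simp: Mon_def in_keys_iff split: if_splits)
qed

lemma mon_degree_le_total_degree: "e \<in> Mon P \<Longrightarrow> mon_degree e \<le> total_degree P"
  unfolding total_degree_def by (intro Max_ge) (auto simp: Mon_def)

text \<open>
  A point \<open>y\<close> is a zero of \<open>I\<^sup>\<nu>\<close> if and only if \<open>spread \<nu> y\<close> is a zero of \<open>I\<close>, so each \<open>\<Phi>\<^sub>\<nu>\<close> only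
  yields orbits of zeros, and the orbit of a zero already arises from \<open>\<Phi>\<^sub>\<nu>\<close> for its own orbit type
  \<open>\<nu>\<close>. This makes the second formulation of the theorem a consequence of the first.
\<close>
lemma Sn_orbits_zero_set_eq_UN_Phi:
  fixes I :: "'a::field mpol set"
  assumes "symmetric_ideal n I"
    and "\<And>x. x \<in> zero_set n I \<Longrightarrow> orbit_type x \<in> T"
    and "\<And>\<nu>. \<nu> \<in> T \<Longrightarrow> sum_list \<nu> = n"
  shows "Sn_orbits (zero_set n I) = (\<Union>\<nu>\<in>T. Phi \<nu> ` zero_set (length \<nu>) (merge_vars \<nu> ` I))"
proof -
  have mem: "y \<in> zero_set (length \<nu>) (merge_vars \<nu> ` I) \<longleftrightarrow> spread \<nu> y \<in> zero_set n I"
    if "sum_list \<nu> = n" "length y = length \<nu>" for \<nu> y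
    using that mpol_eval_merge_vars[OF that(2)] mpol_support_symmetric_ideal[OF assms(1)]
    by (auto simp: zero_set_def length_spread)
  show ?thesis
  proof (intro equalityI subsetI)
    fix Y assume "Y \<in> Sn_orbits (zero_set n I)"
    then obtain x where x: "x \<in> zero_set n I" "Y = Sn_orbit x"
      by (auto simp: Sn_orbits_def)
    obtain y where y: "length y = length (orbit_type x)" "mset (spread (orbit_type x) y) = mset x"
      by (rule obtain_spread_orbit_type)
    have "y \<in> zero_set (length (orbit_type x)) (merge_vars (orbit_type x) ` I)"
      using mem[OF assms(3)[OF assms(2)[OF x(1)]] y(1)] zero_set_mset_cong[OF assms(1) x(1) y(2)] by blast
    moreover have "Y = Phi (orbit_type x) y"
      using x(2) y(2) by (simp add: Phi_def Sn_orbit_eq)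
    ultimately show "Y \<in> (\<Union>\<nu>\<in>T. Phi \<nu> ` zero_set (length \<nu>) (merge_vars \<nu> ` I))"
      using assms(2)[OF x(1)] by blast
  next
    fix Y assume "Y \<in> (\<Union>\<nu>\<in>T. Phi \<nu> ` zero_set (length \<nu>) (merge_vars \<nu> ` I))"
    then obtain \<nu> y where \<nu>: "\<nu> \<in> T" "y \<in> zero_set (length \<nu>) (merge_vars \<nu> ` I)" "Y = Phi \<nu> y"
      by blast
    then have "spread \<nu> y \<in> zero_set n I"
      using mem[OF assms(3)[OF \<nu>(1)], of y] by (simp add: zero_set_def)
    then show "Y \<in> Sn_orbits (zero_set n I)"
      using \<nu>(3) by (simp add: Sn_orbits_def Phi_def)
  qed
qed

theorem theorem4:
  fixes n d :: nat
    and I :: "'a::field mpol set"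
    and P :: "'a mpol"
    and m :: "nat \<Rightarrow>\<^sub>0 nat"
  assumes "symmetric_ideal n I"
    and "P \<in> I"
    and "total_degree P = d"
    and "wt (hom_component d P) + d \<le> n"
    and "m \<in> Mon (hom_component d P)"
  shows "(\<forall>\<kappa>. is_partition n \<kappa> \<longrightarrow> \<kappa> \<unlhd> dual_partition (mon_partition n m) \<longrightarrow>
            zero_set n I \<inter> points_of_type n \<kappa> = {}) \<and>
         Sn_orbits (zero_set n I) =
           (\<Union>\<nu>\<in>{\<nu>. is_partition n \<nu> \<and> \<not> \<nu> \<unlhd> dual_partition (mon_partition n m)}.
              Phi \<nu> ` zero_set (length \<nu>) (merge_vars \<nu> ` I))"
proof -
  have m: "m \<in> Mon P" "mon_degree m = d"
    using assms(5) by (simp_all add: Mon_hom_component)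
  have not_dom: "\<not> orbit_type x \<unlhd> dual_partition (mon_partition n m)" if "x \<in> zero_set n I" for x
  proof (rule zero_orbit_type_not_dominated[OF assms(1,2) m(1) _ refl _ that])
    show "mon_degree e \<le> mon_degree m" if "e \<in> Mon P" for e
      using mon_degree_le_total_degree[OF that] assms(3) m(2) by simp
    show "card (\<Union>e\<in>{e \<in> Mon P. mon_degree e = mon_degree m}. mon_support e) + mon_degree m \<le> n"
      using assms(4) m(2) by (simp add: wt_def mpol_support_def Mon_hom_component)
  qed
  have "Sn_orbits (zero_set n I) =
      (\<Union>\<nu>\<in>{\<nu>. is_partition n \<nu> \<and> \<not> \<nu> \<unlhd> dual_partition (mon_partition n m)}.
         Phi \<nu> ` zero_set (length \<nu>) (merge_vars \<nu> ` I))"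
  proof (rule Sn_orbits_zero_set_eq_UN_Phi[OF assms(1)])
    fix x assume x: "x \<in> zero_set n I"
    then show "orbit_type x \<in> {\<nu>. is_partition n \<nu> \<and> \<not> \<nu> \<unlhd> dual_partition (mon_partition n m)}"
      using not_dom[OF x] orbit_type_is_partition[of x] by (simp add: zero_set_def)
  qed (simp add: is_partition_def)
  then show ?thesis
    using not_dom by (auto simp: points_of_type_def)
qed

end
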